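(* For all positive integers $M,N$ and $\{x\}=\{x_1,\dots,x_N\}$, $$\mathbf{B}^{*}(x_1)\cdots \mathbf{B}^{*}(x_N)|0\rangle=\exp\left(\sum_{\substack{1\leq m\leq M \\ 1\leq n\leq N}}(-1)^{m-1}s_{(m,1^{n-1})}\{x\}\,\varphi_{-m}\varphi^*_{1-n}\right)|0\rangle .$$
   Context: The charged free bosons $\varphi_i,\varphi^*_i$ ($i\in\mathbb Z$) satisfy $[\varphi_i,\varphi^*_j]=\delta_{i,-j}$, $[\varphi_i,\varphi_j]=[\varphi^*_i,\varphi^*_j]=0$. The Fock space $\mathcal M$ is generated by $|0\rangle$ with $\varphi_i|0\rangle=\varphi^*_{i+1}|0\rangle=0$ for $i\ge0$. For a fixed positive integer $M$, $$\mathbf B^*(x)=\exp(x\varphi_{-M}\varphi^*_{M-1})\exp(x\varphi_{-M+1}\varphi^*_{M-2})\cdots,$$ i.e. the ordered product of $\exp(x\varphi_{-i}\varphi^*_{i-1})$ over $i\le M$, $i$ decreasing from left to right; for each fixed vector and each power of $x$ only finitely many terms contribute. The identity holds in the completion of $\mathcal M$ by its gradation ($\deg\varphi_{-m}=\deg\varphi^*_{-m}=m$), equivalently as formal power series in $x_1,\dots,x_N$ with coefficients in $\mathcal M$. $s_{(m,1^{n-1})}\{x\}$ is the Schur polynomial in $x_1,\dots,x_N$ of the hook partition $(m,1,\dots,1)$ with $n-1$ ones. *)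

theory Defs
  imports Complex_Main "HOL-Library.Poly_Mapping" "HOL-Library.FuncSet"
begin

section \<open>The Fock space of the charged free bosons\<close>

text \<open>
  The Fock space is described by its defining properties: a vector space with operators
  \<open>phi i\<close>, \<open>phis i\<close> (the latter being the starred modes) satisfying the commutation relations,
  and a non-zero vacuum vector that satisfies the annihilation conditions and generates the
  space. In characteristic zero these properties determine the space up to isomorphism.
\<close>

locale charged_free_bosons_fock = vector_space scale
  for scale :: "'k::field_char_0 \<Rightarrow> 'v::ab_group_add \<Rightarrow> 'v" +
  fixes phi phis :: "int \<Rightarrow> 'v \<Rightarrow> 'v" and vac :: 'v
  assumes linear_phi: "Vector_Spaces.linear scale scale (phi i)"
    and linear_phis: "Vector_Spaces.linear scale scale (phis i)"
    and comm_phi_phis: "phi i (phis j v) - phis j (phi i v) = (if i = - j then v else 0)"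
    and comm_phi_phi: "phi i (phi j v) - phi j (phi i v) = 0"
    and comm_phis_phis: "phis i (phis j v) - phis j (phis i v) = 0"
    and phi_vac: "i \<ge> 0 \<Longrightarrow> phi i vac = 0"
    and phis_vac: "i \<ge> 0 \<Longrightarrow> phis (i + 1) vac = 0"
    and vac_nonzero: "vac \<noteq> 0"
    and generated: "\<lbrakk>subspace S; vac \<in> S; \<And>i v. v \<in> S \<Longrightarrow> phi i v \<in> S;
                     \<And>i v. v \<in> S \<Longrightarrow> phis i v \<in> S\<rbrakk> \<Longrightarrow> S = UNIV"

section \<open>Polynomials and formal power series in the variables x\<close>

text \<open>
  A monomial is a finitely supported exponent function, a polynomial is an element of the
  monoid algebra over the monomials, and a power series with coefficients in \<open>'v\<close> is an
  arbitrary function from monomials to \<open>'v\<close>. The set of variables is not built into the types;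
  a series in \<open>x\<^sub>1, \<dots>, x\<^sub>N\<close> has zero coefficient at any monomial involving another variable.
\<close>

type_synonym expo = "nat \<Rightarrow>\<^sub>0 nat"
type_synonym 'k pol = "expo \<Rightarrow>\<^sub>0 'k"
type_synonym 'v series = "expo \<Rightarrow> 'v"

definition pvar :: "nat \<Rightarrow> 'k::comm_ring_1 pol" where
  "pvar j = Poly_Mapping.single (Poly_Mapping.single j 1) 1"

definition const_series :: "'v::zero \<Rightarrow> 'v series" where
  "const_series v = (\<lambda>\<alpha>. if \<alpha> = 0 then v else 0)"

lemma finite_expo_decompositions: "finite {(\<beta>, \<gamma>). \<beta> + \<gamma> = (\<alpha>::expo)}"
proof -
  let ?B = "{\<beta>. \<exists>\<gamma>. \<beta> + \<gamma> = \<alpha>}"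
  let ?d = "\<Sum>i\<in>Poly_Mapping.keys \<alpha>. Poly_Mapping.lookup \<alpha> i"
  let ?F = "{f. \<forall>i. (i \<in> Poly_Mapping.keys \<alpha> \<longrightarrow> f i \<in> {..?d}) \<and>
                     (i \<notin> Poly_Mapping.keys \<alpha> \<longrightarrow> f i = 0)}"
  have "Poly_Mapping.lookup \<beta> \<in> ?F" if "\<beta> \<in> ?B" for \<beta>
  proof -
    have le: "Poly_Mapping.lookup \<beta> i \<le> Poly_Mapping.lookup \<alpha> i" for i
      using that by (auto simp: lookup_add)
    have "Poly_Mapping.lookup \<alpha> i \<le> ?d" if "i \<in> Poly_Mapping.keys \<alpha>" for i
      using that by (intro member_le_sum) simp_all
    moreover have "Poly_Mapping.lookup \<beta> i = 0" if "i \<notin> Poly_Mapping.keys \<alpha>" for i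
      using that le[of i] by (simp add: in_keys_iff)
    ultimately show ?thesis
      using order_trans[OF le] by (simp only: mem_Collect_eq atMost_iff) blast
  qed
  then have "Poly_Mapping.lookup ` ?B \<subseteq> ?F"
    by (rule image_subsetI)
  moreover have "finite ?F"
    by (rule finite_set_of_finite_funs) simp_all
  ultimately have "finite (Poly_Mapping.lookup ` ?B)"
    by (rule finite_subset)
  then have "finite ?B"
    by (rule finite_imageD) (meson inj_on_def lookup_inject)
  moreover have "{(\<beta>, \<gamma>). \<beta> + \<gamma> = \<alpha>} \<subseteq> (\<lambda>\<beta>. (\<beta>, \<alpha> - \<beta>)) ` ?B"
    by auto
  ultimately show ?thesis
    by (meson finite_imageI finite_subset)
qed

definition pol_mult :: "('k::comm_ring_1 \<Rightarrow> 'v::ab_group_add \<Rightarrow> 'v) \<Rightarrow> 'k pol \<Rightarrow> 'v series \<Rightarrow> 'v series"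
  where "pol_mult scale p F =
    (\<lambda>\<alpha>. \<Sum>(\<beta>, \<gamma>) \<in> {(\<beta>, \<gamma>). \<beta> + \<gamma> = \<alpha>}. scale (Poly_Mapping.lookup p \<beta>) (F \<gamma>))"

text \<open>
  Infinite sums and products are limits in the formal sense: every coefficient of the sequence
  of partial sums or products is eventually constant.
\<close>

definition series_lim :: "(nat \<Rightarrow> 'v series) \<Rightarrow> 'v series" where
  "series_lim S = (\<lambda>\<alpha>. THE v. \<forall>\<^sub>F n in sequentially. S n \<alpha> = v)"

lemma series_limI:
  assumes "\<And>\<alpha>. \<forall>\<^sub>F n in sequentially. S n \<alpha> = F \<alpha>"
  shows "series_lim S = F"
proof
  fix \<alpha>
  show "series_lim S \<alpha> = F \<alpha>"
    unfolding series_lim_def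
  proof (rule the_equality)
    fix v
    assume "\<forall>\<^sub>F n in sequentially. S n \<alpha> = v"
    with assms[of \<alpha>] have "\<forall>\<^sub>F n in sequentially. v = F \<alpha>"
      by eventually_elim simp
    then show "v = F \<alpha>"
      by simp
  qed (rule assms)
qed

definition op_exp :: "('k::field_char_0 \<Rightarrow> 'v::ab_group_add \<Rightarrow> 'v) \<Rightarrow>
    ('v series \<Rightarrow> 'v series) \<Rightarrow> 'v series \<Rightarrow> 'v series" where
  "op_exp scale T F = series_lim (\<lambda>n \<alpha>. \<Sum>k\<le>n. scale (1 / fact k) ((T ^^ k) F \<alpha>))"

section \<open>Schur polynomials\<close>

text \<open>
  The Schur polynomial of a partition in \<open>x\<^sub>1, \<dots>, x\<^sub>N\<close> is the generating function of the
  semistandard tableaux with entries in \<open>{1..N}\<close>. Rows and columns are counted from 0.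
\<close>

definition young_diagram :: "nat list \<Rightarrow> (nat \<times> nat) set" where
  "young_diagram lam = {(r, c). r < length lam \<and> c < lam ! r}"

definition ssyt :: "nat \<Rightarrow> nat list \<Rightarrow> (nat \<times> nat \<Rightarrow> nat) set" where
  "ssyt N lam = {t \<in> young_diagram lam \<rightarrow>\<^sub>E {1..N}.
     (\<forall>r c c'. c < c' \<and> (r, c) \<in> young_diagram lam \<and> (r, c') \<in> young_diagram lam
        \<longrightarrow> t (r, c) \<le> t (r, c')) \<and>
     (\<forall>r r' c. r < r' \<and> (r, c) \<in> young_diagram lam \<and> (r', c) \<in> young_diagram lam
        \<longrightarrow> t (r, c) < t (r', c))}"

definition schur :: "nat \<Rightarrow> nat list \<Rightarrow> 'k::comm_ring_1 pol" where
  "schur N lam = (\<Sum>t\<in>ssyt N lam. \<Prod>b\<in>young_diagram lam. pvar (t b))"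

definition hook :: "nat \<Rightarrow> nat \<Rightarrow> nat list" where
  "hook m n = m # replicate (n - 1) 1"

section \<open>The operators in the identity\<close>

text \<open>Coefficientwise action of \<open>p \<cdot> \<phi>\<^sub>a \<phi>\<^sup>*\<^sub>b\<close> on power series, for a polynomial \<open>p\<close>.\<close>

definition bilin :: "('k::field_char_0 \<Rightarrow> 'v::ab_group_add \<Rightarrow> 'v) \<Rightarrow>
    (int \<Rightarrow> 'v \<Rightarrow> 'v) \<Rightarrow> (int \<Rightarrow> 'v \<Rightarrow> 'v) \<Rightarrow> 'k pol \<Rightarrow> int \<Rightarrow> int \<Rightarrow> 'v series \<Rightarrow> 'v series" where
  "bilin scale phi phis p a b F = pol_mult scale p (\<lambda>\<alpha>. phi a (phis b (F \<alpha>)))"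

text \<open>
  \<open>Bstar scale phi phis M j\<close> is \<open>B\<^sup>*(x\<^sub>j)\<close>. The factors of the partial product are
  \<open>exp (x\<^sub>j \<phi>\<^bsub>-i\<^esub> \<phi>\<^sup>*\<^bsub>i-1\<^esub>)\<close> for \<open>i = M, M - 1, \<dots>, M - n + 1\<close> from left to right;
  \<open>i\<close> runs to minus infinity.
\<close>

definition Bstar_partial :: "('k::field_char_0 \<Rightarrow> 'v::ab_group_add \<Rightarrow> 'v) \<Rightarrow>
    (int \<Rightarrow> 'v \<Rightarrow> 'v) \<Rightarrow> (int \<Rightarrow> 'v \<Rightarrow> 'v) \<Rightarrow> nat \<Rightarrow> nat \<Rightarrow> nat \<Rightarrow> 'v series \<Rightarrow> 'v series" where
  "Bstar_partial scale phi phis M j n F =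
     foldr (\<lambda>k. let i = int M - int k in
              op_exp scale (bilin scale phi phis (pvar j) (- i) (i - 1)))
       [0..<n] F"

definition Bstar :: "('k::field_char_0 \<Rightarrow> 'v::ab_group_add \<Rightarrow> 'v) \<Rightarrow>
    (int \<Rightarrow> 'v \<Rightarrow> 'v) \<Rightarrow> (int \<Rightarrow> 'v \<Rightarrow> 'v) \<Rightarrow> nat \<Rightarrow> nat \<Rightarrow> 'v series \<Rightarrow> 'v series" where
  "Bstar scale phi phis M j F = series_lim (\<lambda>n. Bstar_partial scale phi phis M j n F)"

definition hook_exponent :: "('k::field_char_0 \<Rightarrow> 'v::ab_group_add \<Rightarrow> 'v) \<Rightarrow>
    (int \<Rightarrow> 'v \<Rightarrow> 'v) \<Rightarrow> (int \<Rightarrow> 'v \<Rightarrow> 'v) \<Rightarrow> nat \<Rightarrow> nat \<Rightarrow> 'v series \<Rightarrow> 'v series" where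
  "hook_exponent scale phi phis M N F =
     (\<lambda>\<alpha>. \<Sum>m\<in>{1..M}. \<Sum>n\<in>{1..N}.
        bilin scale phi phis ((- 1) ^ (m - 1) * schur N (hook m n)) (- int m) (1 - int n) F \<alpha>)"

end

theory Submission
  imports Defs "HOL-Library.Function_Algebras"
begin

text \<open>
  Write \<open>X k = \<phi>\<^bsub>-k\<^esub> \<phi>\<^sup>*\<^bsub>k-1\<^esub>\<close>, so that \<open>B\<^sup>*(x)\<close> is the ordered product of the factors \<open>exp (x X k)\<close>, and
  for a matrix \<open>c\<close> of polynomials put \<open>H(c) = \<Sum> c(m,n) \<phi>\<^bsub>-m\<^esub> \<phi>\<^sup>*\<^bsub>1-n\<^esub>\<close> with \<open>m, n \<ge> 1\<close>. The proof tracks the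
  coherent vectors \<open>exp (H(c)) |0>\<close> and shows that each factor sends a coherent vector to another
  one, so that only the matrix \<open>c\<close> changes.
  
  The modes occurring in \<open>H(c)\<close> are all creation operators, so any two such sums commute. For
  \<open>k \<noteq> 1\<close> the operator \<open>X k\<close> kills the vacuum, and its commutator with \<open>H(c)\<close> is again of the form
  \<open>H(c')\<close> and commutes with \<open>X k\<close>. If \<open>[A, H] = D\<close>, where \<open>D\<close> commutes with \<open>A\<close> and \<open>H\<close>, and \<open>A v = 0\<close>,
  then \<open>exp(A) exp(H) v = exp(D + H) v\<close> (lemma \<open>op_exp_op_exp\<close>). Hence \<open>exp (x X k)\<close> replaces \<open>c\<close> by
  \<open>c + c'\<close>. For \<open>k = 1\<close> the operator \<open>X 1\<close> is itself one of the summands of \<open>H\<close>, and \<open>x\<close> is added to the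
  entry \<open>c(1,1)\<close>.
  
  Going through all factors, from \<open>k\<close> very negative up to \<open>k = M\<close>: the factors with \<open>k \<le> 0\<close> add to each
  column \<open>x\<close> times the previous column, the factor \<open>k = 1\<close> adds \<open>x\<close> to the corner, and the factors with
  \<open>k \<ge> 2\<close> subtract from row \<open>k\<close> the product of \<open>x\<close> and the new row \<open>k - 1\<close>. Thus \<open>B\<^sup>*(x)\<close> turns \<open>c\<close> into the
  matrix \<open>d\<close> with
  \<open>d(m,n) = c(m,n) + x c(m,n-1) - x d(m-1,n)\<close>, plus \<open>x\<close> at the corner (lemma \<open>Bstar_coherent\<close>).
  
  Up to the sign \<open>(-1)\<^bsup>m-1\<^esup>\<close> this is the recursion of hook Schur polynomials obtained by adjoining a
  letter smaller than all others (lemma \<open>hook_schur_insert_min\<close>). The operators act in the order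
  \<open>B\<^sup>*(x\<^sub>N), \<dots>, B\<^sup>*(x\<^sub>1)\<close>, so the new letter is always the smallest one and the theorem follows by
  induction on the number of letters.
\<close>

section \<open>Exponentials of degree-raising operators on formal series\<close>

definition degree_of :: "expo \<Rightarrow> nat" where
  "degree_of \<alpha> = (\<Sum>i\<in>Poly_Mapping.keys \<alpha>. Poly_Mapping.lookup \<alpha> i)"

lemma degree_of_add: "degree_of (\<alpha> + \<beta>) = degree_of \<alpha> + degree_of \<beta>"
proof -
  let ?K = "Poly_Mapping.keys \<alpha> \<union> Poly_Mapping.keys \<beta>"
  have *: "degree_of \<gamma> = (\<Sum>i\<in>?K. Poly_Mapping.lookup \<gamma> i)"
    if "Poly_Mapping.keys \<gamma> \<subseteq> ?K" for \<gamma>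
    unfolding degree_of_def using that
    by (intro sum.mono_neutral_left) (auto simp: in_keys_iff)
  have "Poly_Mapping.keys (\<alpha> + \<beta>) \<subseteq> ?K"
    by (rule keys_add)
  then show ?thesis
    by (simp add: * lookup_add sum.distrib)
qed

lemma degree_of_eq_0_iff: "degree_of \<alpha> = 0 \<longleftrightarrow> \<alpha> = 0"
proof
  assume "degree_of \<alpha> = 0"
  then have "Poly_Mapping.lookup \<alpha> i = 0" for i
    by (cases "i \<in> Poly_Mapping.keys \<alpha>") (auto simp: degree_of_def in_keys_iff)
  then show "\<alpha> = 0"
    by (intro poly_mapping_eqI) simp
qed (simp add: degree_of_def)

lemma sum_series_apply: "(\<Sum>i\<in>I. F i) \<alpha> = (\<Sum>i\<in>I. F i \<alpha>)"
  for F :: "'i \<Rightarrow> 'v::ab_group_add series"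
  by (induction I rule: infinite_finite_induct) simp_all

lemma series_minus_apply: "(F - G) \<alpha> = F \<alpha> - G \<alpha>"
  for F :: "'v::ab_group_add series"
  by (simp add: fun_diff_def)

text \<open>
  Every operator exponentiated below raises the degree in the variables by at least one. For such
  operators a coefficient of the exponential series is a finite sum, so the limits in the
  definition of the exponential never have to be discussed beyond lemma \<open>op_exp_coeff\<close>.
\<close>

definition vanishes_below :: "nat \<Rightarrow> 'v::zero series \<Rightarrow> bool" where
  "vanishes_below d F \<longleftrightarrow> (\<forall>\<alpha>. degree_of \<alpha> < d \<longrightarrow> F \<alpha> = 0)"

definition series_scale :: "('k \<Rightarrow> 'v \<Rightarrow> 'v) \<Rightarrow> 'k \<Rightarrow> 'v series \<Rightarrow> 'v series" where
  "series_scale scale c F = (\<lambda>\<alpha>. scale c (F \<alpha>))"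

lemma series_scale_apply [simp]: "series_scale scale c F \<alpha> = scale c (F \<alpha>)"
  by (simp add: series_scale_def)

lemma funpow_commute:
  assumes "\<And>F. A (D F) = D (A F)"
  shows "A ((D ^^ k) F) = (D ^^ k) (A F)"
  by (induction k) (simp_all add: assms)

lemma funpow_cong_eigen:
  assumes "A G = D G" "\<And>F. A (D F) = D (A F)"
  shows "(A ^^ k) G = (D ^^ k) G"
proof (induction k)
  case (Suc k)
  have "(A ^^ Suc k) G = A ((D ^^ k) G)"
    by (simp only: funpow.simps comp_apply Suc)
  also have "\<dots> = (D ^^ k) (D G)"
    by (simp only: funpow_commute[where A = A and D = D, OF assms(2)] assms(1))
  also have "\<dots> = (D ^^ Suc k) G"
    by (simp only: funpow_Suc_right comp_apply)
  finally show ?case .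
qed simp

locale formal_series = vector_space scale
  for scale :: "'k::field_char_0 \<Rightarrow> 'v::ab_group_add \<Rightarrow> 'v"
begin

abbreviation sscale :: "'k \<Rightarrow> 'v series \<Rightarrow> 'v series" where "sscale \<equiv> series_scale scale"

sublocale series: vector_space sscale
  by unfold_locales (auto simp: fun_eq_iff scale_right_distrib scale_left_distrib)

text \<open>
  The case \<open>r = 0\<close> covers operators acting coefficientwise, such as the modes themselves; additivity of
  \<open>r\<close> under composition then gives the degree of every operator in use.
\<close>

definition raises :: "nat \<Rightarrow> ('v series \<Rightarrow> 'v series) \<Rightarrow> bool" where
  "raises r T \<longleftrightarrow> Vector_Spaces.linear sscale sscale T \<and>
     (\<forall>d F. vanishes_below d F \<longrightarrow> vanishes_below (d + r) (T F))"

lemma raisesI: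
  assumes "\<And>F G. T (F + G) = T F + T G" "\<And>c F. T (sscale c F) = sscale c (T F)"
    and "\<And>d F. vanishes_below d F \<Longrightarrow> vanishes_below (d + r) (T F)"
  shows "raises r T"
  unfolding raises_def
  by (intro conjI allI impI) (auto intro!: assms Vector_Spaces.linear.intro
      module_hom.intro module_hom_axioms.intro series.module_axioms series.vector_space_axioms)

lemma raises_linear:
  assumes "raises r T"
  shows "T (F + G) = T F + T G" "T (F - G) = T F - T G" "T (sscale c F) = sscale c (T F)" "T 0 = 0"
    "T (\<Sum>i\<in>I. X i) = (\<Sum>i\<in>I. T (X i))"
proof -
  have "Vector_Spaces.linear sscale sscale T"
    using assms by (simp add: raises_def)
  then interpret module_hom sscale sscale T
    by (simp add: module_hom_iff_linear)
  show "T (F + G) = T F + T G" "T (F - G) = T F - T G" "T (sscale c F) = sscale c (T F)" "T 0 = 0"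
    "T (\<Sum>i\<in>I. X i) = (\<Sum>i\<in>I. T (X i))"
    by (auto intro: add diff scale sum)
qed

lemma raises_vanishes: "raises r T \<Longrightarrow> vanishes_below d F \<Longrightarrow> vanishes_below (d + r) (T F)"
  by (simp add: raises_def)

lemma raises_mono: "raises r T \<Longrightarrow> s \<le> r \<Longrightarrow> raises s T"
  unfolding raises_def vanishes_below_def by auto

lemma raises_id: "raises 0 (\<lambda>F. F)"
  by (rule raisesI) auto

lemma raises_comp:
  assumes T: "raises r T" and S: "raises s S"
  shows "raises (r + s) (\<lambda>F. T (S F))"
proof (rule raisesI)
  fix d and F :: "'v series"
  assume "vanishes_below d F"
  then have "vanishes_below (d + s + r) (T (S F))"
    by (intro raises_vanishes[OF T] raises_vanishes[OF S])
  then show "vanishes_below (d + (r + s)) (T (S F))"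
    by (simp add: ac_simps)
qed (simp_all add: raises_linear[OF T] raises_linear[OF S])

lemma raises_add:
  assumes T: "raises r T" and S: "raises r S"
  shows "raises r (\<lambda>F. T F + S F)"
proof (rule raisesI)
  fix d and F :: "'v series"
  assume "vanishes_below d F"
  then show "vanishes_below (d + r) (T F + S F)"
    using raises_vanishes[OF T, of d F] raises_vanishes[OF S, of d F]
    by (simp add: vanishes_below_def)
qed (simp_all add: raises_linear[OF T] raises_linear[OF S] series.scale_right_distrib)

lemma raises_zero: "raises r (\<lambda>F. 0)"
  by (rule raisesI) (auto simp: vanishes_below_def)

lemma raises_sum: "(\<And>i. i \<in> I \<Longrightarrow> raises r (T i)) \<Longrightarrow> raises r (\<lambda>F. \<Sum>i\<in>I. T i F)"
  by (induction I rule: infinite_finite_induct) (auto intro: raises_add raises_zero)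

lemma raises_funpow: "raises 1 T \<Longrightarrow> raises k (T ^^ k)"
proof (induction k)
  case 0
  then show ?case using raises_id by (simp add: id_def)
next
  case (Suc k)
  then show ?case using raises_comp[of 1 T k "T ^^ k"] by (simp add: comp_def)
qed

lemma raises_coeff_zero: "raises r T \<Longrightarrow> degree_of \<alpha> < r \<Longrightarrow> T F \<alpha> = 0"
  using raises_vanishes[of r T 0 F] by (simp add: vanishes_below_def)

lemma op_exp_coeff:
  assumes "raises 1 T" "degree_of \<alpha> \<le> n"
  shows "op_exp scale T F \<alpha> = (\<Sum>k\<le>n. scale (1 / fact k) ((T ^^ k) F \<alpha>))"
proof -
  let ?S = "\<lambda>n \<alpha>. \<Sum>k\<le>n. scale (1 / fact k) ((T ^^ k) F \<alpha>)"
  have stable: "?S n \<beta> = ?S (degree_of \<beta>) \<beta>" if "degree_of \<beta> \<le> n" for n \<beta>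
    using that raises_coeff_zero[OF raises_funpow[OF assms(1)], of \<beta>]
    by (intro sum.mono_neutral_right) auto
  have "op_exp scale T F = (\<lambda>\<alpha>. ?S (degree_of \<alpha>) \<alpha>)"
    unfolding op_exp_def
    by (rule series_limI) (auto simp only: eventually_at_top_linorder intro: stable)
  then show ?thesis
    using stable[OF assms(2)] by simp
qed

lemma raises_op_exp_coeff:
  assumes "raises 1 T" "raises 0 S" "degree_of \<alpha> \<le> n"
  shows "S (op_exp scale T F) \<alpha> = (\<Sum>k\<le>n. scale (1 / fact k) (S ((T ^^ k) F) \<alpha>))"
proof -
  let ?P = "\<Sum>k\<le>n. sscale (1 / fact k) ((T ^^ k) F)"
  have "vanishes_below (Suc n) (op_exp scale T F - ?P)"
    by (auto simp: vanishes_below_def op_exp_coeff[OF assms(1), of _ n] sum_series_apply series_minus_apply)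
  from raises_vanishes[OF assms(2) this] have "S (op_exp scale T F) \<alpha> = S ?P \<alpha>"
    using assms(3) by (simp add: vanishes_below_def raises_linear(2)[OF assms(2)] series_minus_apply)
  then show ?thesis
    by (simp add: raises_linear[OF assms(2)] sum_series_apply)
qed

lemma op_exp_zero_op: "op_exp scale (\<lambda>F. 0) F = F"
proof
  fix \<alpha>
  have *: "(((\<lambda>F. 0) ^^ k) F) \<alpha> = (if k = 0 then F \<alpha> else 0)" for k
    by (cases k) auto
  have "op_exp scale (\<lambda>F. 0) F \<alpha> = (\<Sum>k\<le>degree_of \<alpha>. if k = 0 then F \<alpha> else 0)"
    unfolding op_exp_coeff[OF raises_zero order_refl] * by (intro sum.cong) auto
  then show "op_exp scale (\<lambda>F. 0) F \<alpha> = F \<alpha>"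
    by simp
qed

text \<open>
  Since \<open>A\<close> and \<open>D\<close> commute, \<open>A\<^sup>k G = D\<^sup>k G\<close> follows from the case \<open>k = 1\<close>; the operators themselves
  may be different.
\<close>

lemma op_exp_cong_eigen:
  assumes "A G = D G" "\<And>F. A (D F) = D (A F)"
  shows "op_exp scale A G = op_exp scale D G"
  unfolding op_exp_def funpow_cong_eigen[where A = A and D = D, OF assms] ..

lemma fact_cancel: "1 / fact (Suc k) * of_nat (Suc k) = (1 / fact k :: 'k)"
  by (simp add: divide_simps del: of_nat_Suc)

text \<open>
  Commuting \<open>A\<close> through \<open>H\<^sup>k\<close> gives \<open>A H\<^sup>k v = k D H\<^bsup>k-1\<^esup> v\<close>, because the term \<open>H\<^sup>k A v\<close> vanishes. Hence
  \<open>A\<close> acts on \<open>exp(H) v\<close> as the derivative of the exponential series in the direction \<open>D\<close>.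
\<close>

lemma op_exp_commutator:
  assumes A: "raises 1 A" and H: "raises 1 H" and D: "raises 1 D"
    and AH: "\<And>F. A (H F) = H (A F) + D F" and HD: "\<And>F. H (D F) = D (H F)" and v: "A v = 0"
  shows "A (op_exp scale H v) = D (op_exp scale H v)"
proof
  fix \<alpha>
  let ?n = "degree_of \<alpha>"
  have pow: "A ((H ^^ Suc k) v) = sscale (of_nat (Suc k)) (D ((H ^^ k) v))" for k
  proof (induction k)
    case 0
    then show ?case using AH[of v] by (simp add: v raises_linear[OF H])
  next
    case (Suc k)
    have "A ((H ^^ Suc (Suc k)) v) = H (A ((H ^^ Suc k) v)) + D ((H ^^ Suc k) v)"
      by (simp add: AH)
    also have "\<dots> = sscale (of_nat (Suc k)) (D ((H ^^ Suc k) v)) + D ((H ^^ Suc k) v)"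
      by (simp only: Suc raises_linear[OF H] HD) (simp add: HD)
    also have "\<dots> = sscale (of_nat (Suc (Suc k))) (D ((H ^^ Suc k) v))"
      unfolding of_nat_Suc[of "Suc k"] series.scale_left_distrib series.scale_one by (rule add.commute)
    finally show ?case .
  qed
  have "A (op_exp scale H v) \<alpha> = (\<Sum>k\<le>Suc ?n. scale (1 / fact k) (A ((H ^^ k) v) \<alpha>))"
    by (rule raises_op_exp_coeff[OF H raises_mono[OF A]]) auto
  \<comment> \<open>The index is shifted: the term for \<open>k = 0\<close> is \<open>A v = 0\<close>.\<close>
  also have "\<dots> = (\<Sum>k\<le>?n. scale (1 / fact (Suc k)) (A ((H ^^ Suc k) v) \<alpha>))"
    by (subst sum.atMost_Suc_shift) (simp add: v del: funpow.simps(2))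
  also have "\<dots> = (\<Sum>k\<le>?n. scale (1 / fact k) (D ((H ^^ k) v) \<alpha>))"
    by (simp only: pow series_scale_apply scale_scale fact_cancel)
  also have "\<dots> = D (op_exp scale H v) \<alpha>"
    by (rule raises_op_exp_coeff[OF H raises_mono[OF D], symmetric]) auto
  finally show "A (op_exp scale H v) \<alpha> = D (op_exp scale H v) \<alpha>" .
qed

text \<open>
  The binomial theorem for commuting operators, divided by \<open>n!\<close>. With \<open>t(k,l) = D\<^sup>k/k! H\<^sup>l/l!\<close> one has
  \<open>D t(k,l) = (k + 1) t(k+1,l)\<close> and \<open>H t(k,l) = (l + 1) t(k,l+1)\<close>, so in the induction step the coefficients
  that meet at \<open>t(k,n+1-k)\<close> add up to \<open>k + (n + 1 - k) = n + 1\<close>.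
\<close>

lemma divided_power_add:
  assumes D: "raises 1 D" and H: "raises 1 H" and HD: "\<And>F. H (D F) = D (H F)"
  shows "sscale (1 / fact n) (((\<lambda>F. D F + H F) ^^ n) F) =
    (\<Sum>k\<le>n. sscale (1 / fact k * (1 / fact (n - k))) ((D ^^ k) ((H ^^ (n - k)) F)))"
proof (induction n)
  case (Suc n)
  define t where "t k l = sscale (1 / fact k * (1 / fact l)) ((D ^^ k) ((H ^^ l) F))" for k l
  have HDk: "H ((D ^^ k) G) = (D ^^ k) (H G)" for k G
    by (rule funpow_commute[where A = H and D = D, OF HD])
  have Dt: "D (t k l) = sscale (of_nat (Suc k)) (t (Suc k) l)" for k l
    by (simp add: t_def raises_linear[OF D] field_simps del: of_nat_Suc)
  have Ht: "H (t k l) = sscale (of_nat (Suc l)) (t k (Suc l))" for k l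
    by (simp add: t_def raises_linear[OF H] HDk field_simps del: of_nat_Suc)
  have DHt: "raises 1 (\<lambda>F. D F + H F)"
    by (rule raises_add[OF D H])
  have "sscale (of_nat (Suc n)) (sscale (1 / fact (Suc n)) (((\<lambda>F. D F + H F) ^^ Suc n) F))
      = (\<lambda>F. D F + H F) (sscale (1 / fact n) (((\<lambda>F. D F + H F) ^^ n) F))"
    by (simp add: raises_linear[OF DHt] field_simps del: of_nat_Suc)
  also have "\<dots> = D (\<Sum>k\<le>n. t k (n - k)) + H (\<Sum>k\<le>n. t k (n - k))"
    by (simp only: Suc t_def)
  also have "D (\<Sum>k\<le>n. t k (n - k)) = (\<Sum>k\<le>n. sscale (of_nat (Suc k)) (t (Suc k) (n - k)))"
    by (simp only: raises_linear(5)[OF D] Dt)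
  also have "\<dots> = (\<Sum>k\<le>Suc n. sscale (of_nat k) (t k (Suc n - k)))"
    by (subst sum.atMost_Suc_shift) simp
  also have "H (\<Sum>k\<le>n. t k (n - k)) = (\<Sum>k\<le>n. sscale (of_nat (Suc n - k)) (t k (Suc n - k)))"
    by (simp only: raises_linear(5)[OF H] Ht) (auto intro!: sum.cong simp: Suc_diff_le)
  also have "\<dots> = (\<Sum>k\<le>Suc n. sscale (of_nat (Suc n - k)) (t k (Suc n - k)))"
    by simp
  also have "(\<Sum>k\<le>Suc n. sscale (of_nat k) (t k (Suc n - k))) + \<dots>
      = (\<Sum>k\<le>Suc n. sscale (of_nat (Suc n)) (t k (Suc n - k)))"
    unfolding sum.distrib[symmetric] series.scale_left_distrib[symmetric] of_nat_add[symmetric]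
    by (intro sum.cong) auto
  also have "\<dots> = sscale (of_nat (Suc n)) (\<Sum>k\<le>Suc n. t k (Suc n - k))"
    by (simp only: series.scale_sum_right)
  finally have "sscale (1 / fact (Suc n)) (((\<lambda>F. D F + H F) ^^ Suc n) F) = (\<Sum>k\<le>Suc n. t k (Suc n - k))"
    by (simp only: series.scale_cancel_left of_nat_eq_0_iff) auto
  then show ?case
    by (simp only: t_def)
qed simp

lemma op_exp_add:
  assumes D: "raises 1 D" and H: "raises 1 H" and HD: "\<And>F. H (D F) = D (H F)"
  shows "op_exp scale D (op_exp scale H F) = op_exp scale (\<lambda>F. D F + H F) F"
proof
  fix \<alpha>
  let ?n = "degree_of \<alpha>"
  let ?t = "\<lambda>k l. sscale (1 / fact k * (1 / fact l)) ((D ^^ k) ((H ^^ l) F)) \<alpha>"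
  have "op_exp scale D (op_exp scale H F) \<alpha> = 
     (\<Sum>k\<le>?n. scale (1 / fact k) ((D ^^ k) (op_exp scale H F) \<alpha>))"
    by (rule op_exp_coeff[OF D]) simp
  also have "\<dots> = (\<Sum>k\<le>?n. \<Sum>l\<le>?n. ?t k l)"
    by (simp add: raises_op_exp_coeff[OF H raises_mono[OF raises_funpow[OF D]] order_refl] scale_sum_right)
  also have "\<dots> = (\<Sum>(k,l)\<in>{..?n} \<times> {..?n}. ?t k l)"
    by (simp add: sum.cartesian_product)
  \<comment> \<open>The square of index pairs may be cut down to the triangle, since \<open>D\<^sup>k H\<^sup>l\<close> raises the degree by
    \<open>k + l\<close>.\<close>
  also have "\<dots> = (\<Sum>(k,l)\<in>{(k,l). k + l \<le> ?n}. ?t k l)"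
  proof (intro sum.mono_neutral_right)
    have "?t k l = 0" if "\<not> k + l \<le> ?n" for k l
      using that raises_coeff_zero[OF raises_comp[OF raises_funpow[OF D, of k] raises_funpow[OF H, of l]], of \<alpha> F]
      by simp
    then show "\<forall>i\<in>{..?n} \<times> {..?n} - {(k, l). k + l \<le> ?n}. (case i of (k, l) \<Rightarrow> ?t k l) = 0"
      by (auto simp del: series_scale_apply)
  qed auto
  also have "\<dots> = (\<Sum>n\<le>?n. \<Sum>k\<le>n. ?t k (n - k))"
    by (rule sum.triangle_reindex_eq)
  also have "\<dots> = (\<Sum>n\<le>?n. sscale (1 / fact n) (((\<lambda>F. D F + H F) ^^ n) F) \<alpha>)"
    by (simp only: divided_power_add[OF assms] sum_series_apply)
  also have "\<dots> = op_exp scale (\<lambda>F. D F + H F) F \<alpha>"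
    by (simp add: op_exp_coeff[OF raises_add[OF D H] order_refl])
  finally show "op_exp scale D (op_exp scale H F) \<alpha> = op_exp scale (\<lambda>F. D F + H F) F \<alpha>" .
qed

text \<open>
  The operator identity \<open>exp(A) exp(H) exp(-A) = exp(H + D)\<close>, applied to a vector killed by \<open>A\<close>. The
  vector \<open>exp(H) v\<close> cannot distinguish \<open>A\<close> from \<open>D\<close>, so \<open>exp(A)\<close> may be replaced by \<open>exp(D)\<close>, which
  commutes with \<open>exp(H)\<close>.
\<close>

lemma op_exp_op_exp:
  assumes A: "raises 1 A" and H: "raises 1 H" and D: "raises 1 D"
    and AH: "\<And>F. A (H F) = H (A F) + D F" and AD: "\<And>F. A (D F) = D (A F)"
    and HD: "\<And>F. H (D F) = D (H F)" and v: "A v = 0"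
  shows "op_exp scale A (op_exp scale H v) = op_exp scale (\<lambda>F. D F + H F) v"
  using op_exp_cong_eigen[where D = D, OF op_exp_commutator[OF A H D AH HD v] AD] op_exp_add[OF D H HD]
  by simp

end

section \<open>Multiplication by polynomials\<close>

lemma lookup_times_eq_sum:
  fixes p q :: "'k::comm_ring_1 pol"
  shows "Poly_Mapping.lookup (p * q) \<alpha> =
    (\<Sum>(\<beta>, \<gamma>)\<in>{(\<beta>, \<gamma>). \<beta> + \<gamma> = \<alpha>}. Poly_Mapping.lookup p \<beta> * Poly_Mapping.lookup q \<gamma>)"
proof -
  have "Poly_Mapping.lookup (p * q) \<alpha> =
      prod_fun (Poly_Mapping.lookup p) (Poly_Mapping.lookup q) \<alpha>"
    by transfer simp
  also have "\<dots> = (\<Sum>(\<beta>, \<gamma>). Poly_Mapping.lookup p \<beta> * Poly_Mapping.lookup q \<gamma> when \<alpha> = \<beta> + \<gamma>)"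
    by (rule prod_fun_unfold_prod) simp_all
  also have "\<dots> = (\<Sum>(\<beta>, \<gamma>)\<in>{(\<beta>, \<gamma>). \<beta> + \<gamma> = \<alpha>}.
      Poly_Mapping.lookup p \<beta> * Poly_Mapping.lookup q \<gamma> when \<alpha> = \<beta> + \<gamma>)"
    by (rule Sum_any.expand_superset[OF finite_expo_decompositions]) auto
  also have "\<dots> = (\<Sum>(\<beta>, \<gamma>)\<in>{(\<beta>, \<gamma>). \<beta> + \<gamma> = \<alpha>}.
      Poly_Mapping.lookup p \<beta> * Poly_Mapping.lookup q \<gamma>)"
    by (intro sum.cong) auto
  finally show ?thesis .
qed

text \<open>
  Vanishing of the constant term is what makes multiplication by a polynomial raise the degree.
\<close>

definition no_const :: "'k::comm_ring_1 pol \<Rightarrow> bool" where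
  "no_const p \<longleftrightarrow> Poly_Mapping.lookup p 0 = 0"

lemma no_const_0: "no_const 0"
  and no_const_add: "no_const p \<Longrightarrow> no_const q \<Longrightarrow> no_const (p + q)"
  and no_const_uminus: "no_const p \<Longrightarrow> no_const (- p)"
  by (simp_all add: no_const_def lookup_add)

lemma no_const_mult: "no_const q \<Longrightarrow> no_const (p * q)"
  unfolding no_const_def lookup_times_eq_sum
proof (intro sum.neutral ballI, clarify)
  fix \<beta> \<gamma> :: expo
  assume q: "Poly_Mapping.lookup q 0 = 0" and "\<beta> + \<gamma> = 0"
  then have "degree_of \<gamma> = 0"
    by (metis add_is_0 degree_of_add degree_of_eq_0_iff)
  then show "Poly_Mapping.lookup p \<beta> * Poly_Mapping.lookup q \<gamma> = 0"
    by (simp add: q degree_of_eq_0_iff)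
qed

lemma no_const_sum: "(\<And>i. i \<in> I \<Longrightarrow> no_const (f i)) \<Longrightarrow> no_const (\<Sum>i\<in>I. f i)"
  by (induction I rule: infinite_finite_induct) (auto intro: no_const_0 no_const_add)

lemma no_const_pvar: "no_const (pvar j)"
proof -
  have "Poly_Mapping.single j (1::nat) \<noteq> 0"
    by (metis lookup_single_eq lookup_zero zero_neq_one)
  then show ?thesis
    by (simp add: no_const_def pvar_def lookup_single)
qed

context formal_series
begin

lemma pol_mult_add: "pol_mult scale (p + q) F = pol_mult scale p F + pol_mult scale q F"
  by (simp add: pol_mult_def fun_eq_iff lookup_add scale_left_distrib sum.distrib split_def)

lemma pol_mult_0: "pol_mult scale 0 F = 0"
  by (simp add: pol_mult_def fun_eq_iff split_def)

lemma pol_mult_uminus: "pol_mult scale (- p) F = - pol_mult scale p F"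
  by (simp add: pol_mult_def fun_eq_iff split_def sum_negf)

lemma raises_pol_mult:
  assumes "r = 0 \<or> r = 1 \<and> no_const p"
  shows "raises r (pol_mult scale p)"
proof (rule raisesI)
  fix d and F :: "'v series"
  assume F: "vanishes_below d F"
  show "vanishes_below (d + r) (pol_mult scale p F)"
    unfolding vanishes_below_def pol_mult_def
  proof (intro allI impI sum.neutral ballI, clarify)
    fix \<beta> \<gamma> :: expo
    assume deg: "degree_of (\<beta> + \<gamma>) < d + r"
    show "scale (Poly_Mapping.lookup p \<beta>) (F \<gamma>) = 0"
    proof (cases "degree_of \<gamma> < d")
      case True
      then show ?thesis using F by (simp add: vanishes_below_def)
    next
      case False
      then have "degree_of \<beta> = 0" "r = 1"
        using deg assms by (auto simp: degree_of_add)
      then show ?thesis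
        using assms by (simp add: degree_of_eq_0_iff no_const_def)
    qed
  qed
qed (auto simp: pol_mult_def fun_eq_iff scale_right_distrib sum.distrib split_def scale_sum_right mult.commute)

lemma pol_mult_pol_mult: "pol_mult scale p (pol_mult scale q F) = pol_mult scale (p * q) F"
proof
  fix \<alpha>
  let ?D = "\<lambda>\<alpha>. {(\<beta>, \<gamma>). \<beta> + \<gamma> = (\<alpha>::expo)}"
  let ?t = "\<lambda>\<beta> \<gamma> \<delta>. scale (Poly_Mapping.lookup p \<beta> * Poly_Mapping.lookup q \<gamma>) (F \<delta>)"
  have fin: "finite (?D \<alpha>)" for \<alpha>
    by (rule finite_expo_decompositions)
  have "pol_mult scale p (pol_mult scale q F) \<alpha> = 
      (\<Sum>b\<in>?D \<alpha>. \<Sum>c\<in>?D (snd b). ?t (fst b) (fst c) (snd c))"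
    by (simp add: pol_mult_def split_def scale_sum_right)
  also have "\<dots> = (\<Sum>(b, c)\<in>(SIGMA b:?D \<alpha>. ?D (snd b)). ?t (fst b) (fst c) (snd c))"
    by (rule sum.Sigma) (auto simp: fin)
  also have "\<dots> = (\<Sum>(b, c)\<in>(SIGMA b:?D \<alpha>. ?D (fst b)). ?t (fst c) (snd c) (snd b))"
    by (rule sum.reindex_bij_witness[where
          i = "\<lambda>(b, c). ((fst c, snd c + snd b), (snd c, snd b))" and
          j = "\<lambda>(b, c). ((fst b + fst c, snd c), (fst b, fst c))"])
       (auto simp: ac_simps)
  also have "\<dots> = (\<Sum>b\<in>?D \<alpha>. \<Sum>c\<in>?D (fst b). ?t (fst c) (snd c) (snd b))"
    by (rule sum.Sigma[symmetric]) (auto simp: fin)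
  also have "\<dots> = pol_mult scale (p * q) F \<alpha>"
    by (simp add: pol_mult_def lookup_times_eq_sum split_def scale_sum_left)
  finally show "pol_mult scale p (pol_mult scale q F) \<alpha> = pol_mult scale (p * q) F \<alpha>" .
qed

end

section \<open>Quadratic expressions in the boson modes\<close>

sublocale charged_free_bosons_fock \<subseteq> formal_series scale
  by unfold_locales

context charged_free_bosons_fock
begin

abbreviation act :: "'k pol \<Rightarrow> int \<Rightarrow> int \<Rightarrow> 'v series \<Rightarrow> 'v series" where
  "act \<equiv> bilin scale phi phis"

lemma raises_coefficientwise:
  assumes "Vector_Spaces.linear scale scale f"
  shows "raises 0 (\<lambda>F \<alpha>. f (F \<alpha>))"
proof -
  interpret module_hom scale scale f
    using assms by (simp add: module_hom_iff_linear)
  show ?thesis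
    by (rule raisesI) (auto simp: fun_eq_iff add scale vanishes_below_def)
qed

lemma pol_mult_coefficientwise:
  assumes "Vector_Spaces.linear scale scale f"
  shows "f (pol_mult scale p F \<alpha>) = pol_mult scale p (\<lambda>\<alpha>. f (F \<alpha>)) \<alpha>"
proof -
  interpret module_hom scale scale f
    using assms by (simp add: module_hom_iff_linear)
  show ?thesis
    by (simp add: pol_mult_def sum split_def scale)
qed

lemma raises_act:
  assumes "no_const p"
  shows "raises 1 (act p a b)"
proof -
  have "raises (1 + (0 + 0)) (\<lambda>F. pol_mult scale p (\<lambda>\<alpha>. phi a (phis b (F \<alpha>))))"
    using assms
    by (intro raises_comp[where T = "pol_mult scale p"] raises_pol_mult
        raises_comp[where T = "\<lambda>F \<alpha>. phi a (F \<alpha>)" and S = "\<lambda>F \<alpha>. phis b (F \<alpha>)"]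
        raises_coefficientwise linear_phi linear_phis) auto
  then show ?thesis
    by (simp add: bilin_def[abs_def])
qed

lemma act_add: "act (p + q) a b F = act p a b F + act q a b F"
  and act_0: "act 0 a b F = 0"
  and act_uminus: "act (- p) a b F = - act p a b F"
  by (simp_all add: bilin_def pol_mult_add pol_mult_0 pol_mult_uminus)

lemma phi_zero: "phi a 0 = 0" and phi_add: "phi a (u + v) = phi a u + phi a v"
  and phi_diff: "phi a (u - v) = phi a u - phi a v"
  using linear_phi[of a] by (auto simp: Vector_Spaces.linear_def module_hom.add module_hom.zero module_hom.diff)

lemma phis_zero: "phis a 0 = 0"
  using linear_phis[of a] by (auto simp: Vector_Spaces.linear_def module_hom.zero)

lemma phi_phis_commutator:
  "phi a (phis b (phi c (phis d v))) = phi c (phis d (phi a (phis b v)))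
     + ((if a = - d then phi c (phis b v) else 0) - (if c = - b then phi a (phis d v) else 0))"
proof -
  have swap: "phis b (phi c u) = phi c (phis b u) - (if c = - b then u else 0)" for b c u
    using comm_phi_phis[of c b u] by (simp add: algebra_simps)
  have "phi a (phis b (phi c (phis d v)))
      = phi a (phi c (phis b (phis d v))) - (if c = - b then phi a (phis d v) else 0)"
    by (simp add: swap phi_diff phi_zero)
  also have "phi a (phi c (phis b (phis d v))) = phi c (phi a (phis d (phis b v)))"
    using comm_phi_phi[of a c] comm_phis_phis[of b d v] by simp
  also have "phi a (phis d (phis b v)) = phis d (phi a (phis b v)) + (if a = - d then phis b v else 0)"
    using swap[of d a "phis b v"] by simp
  finally show ?thesis
    by (simp add: phi_add phi_zero algebra_simps)
qed

text \<open>
  The commutator of two quadratic expressions is quadratic, as in the Lie algebra of infinite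
  matrices; the coefficient polynomials get multiplied.
\<close>

lemma act_act:
  "act p a b (act q c d F) = act q c d (act p a b F)
     + ((if a = - d then act (p * q) c b F else 0) - (if c = - b then act (p * q) a d F else 0))"
proof -
  let ?l = "\<lambda>a b (F :: 'v series) \<alpha>. phi a (phis b (F \<alpha>))"
  have lin: "Vector_Spaces.linear scale scale (\<lambda>v. phi a (phis b v))" for a b
    using Vector_Spaces.linear_compose[OF linear_phis[of b] linear_phi[of a]] by (simp add: comp_def)
  have "act p a b (act q c d F) = pol_mult scale (p * q) (?l a b (?l c d F))" for p q a b c d F
    by (simp add: bilin_def pol_mult_coefficientwise[OF lin] pol_mult_pol_mult)
  note this[of p a b q c d F] this[of q c d p a b F]
  moreover have "?l a b (?l c d F) = ?l c d (?l a b F)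
      + ((if a = - d then ?l c b F else 0) - (if c = - b then ?l a d F else 0))"
    by (rule ext) (simp add: series_minus_apply phi_phis_commutator[of a b c d])
  ultimately show ?thesis
    using raises_linear[OF raises_pol_mult[of 0 "p * q"]]
    by (simp add: bilin_def mult.commute[of q p])
qed

end

section \<open>Hook Schur polynomials\<close>

text \<open>
  A semistandard filling of a hook is stored as its corner entry, the rest of its first row and
  the rest of its first column. The parameters \<open>p\<close> and \<open>k\<close> are the lengths of these two lists, so the
  shape is \<open>(p + 1, 1\<^sup>k)\<close>; the alphabet \<open>A\<close> is arbitrary because the recursion changes it.
\<close>

definition hook_fillings :: "nat set \<Rightarrow> nat \<Rightarrow> nat \<Rightarrow> (nat \<times> nat list \<times> nat list) set" where
  "hook_fillings A p k = {(x, xs, ys). length xs = p \<and> length ys = k \<and> sorted (x # xs) \<and>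
     sorted_wrt (<) (x # ys) \<and> insert x (set xs \<union> set ys) \<subseteq> A}"

definition hook_weight :: "nat \<times> nat list \<times> nat list \<Rightarrow> 'k::comm_ring_1 pol" where
  "hook_weight = (\<lambda>(x, xs, ys). pvar x * prod_list (map pvar xs) * prod_list (map pvar ys))"

definition hook_schur :: "nat set \<Rightarrow> nat \<Rightarrow> nat \<Rightarrow> 'k::comm_ring_1 pol" where
  "hook_schur A p k = sum hook_weight (hook_fillings A p k)"

lemma finite_hook_fillings:
  assumes "finite A"
  shows "finite (hook_fillings A p k)"
proof (rule finite_subset)
  show "hook_fillings A p k \<subseteq>
      A \<times> {xs. set xs \<subseteq> A \<and> length xs = p} \<times> {ys. set ys \<subseteq> A \<and> length ys = k}"
    by (auto simp: hook_fillings_def)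
  show "finite \<dots>"
    using assms by (intro finite_cartesian_product finite_lists_length_eq)
qed

lemma young_diagram_hook:
  "young_diagram (hook (Suc p) (Suc k)) = {(r, c). r = 0 \<and> c < Suc p \<or> r < Suc k \<and> c = 0}"
  by (auto simp: young_diagram_def hook_def nth_Cons split: nat.splits)

lemma prod_list_map_upt: "prod_list (map f [0..<n]) = (\<Prod>i<n. f i)"
  for f :: "nat \<Rightarrow> 'a::comm_monoid_mult"
  by (induction n) (simp_all add: mult.commute)

lemma schur_hook_eq_hook_schur:
  "schur N (hook (Suc p) (Suc k)) = (hook_schur {1..N} p k :: 'k::comm_ring_1 pol)"
proof -
  let ?Y = "{(r, c). r = 0 \<and> c < Suc p \<or> r < Suc k \<and> c = (0::nat)}"
  let ?to = "\<lambda>t. (t (0, 0), map (\<lambda>c. t (0, Suc c)) [0..<p], map (\<lambda>r. t (Suc r, 0)) [0..<k])"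
  let ?from = "\<lambda>(x, xs, ys) (r, c). if (r, c) \<in> ?Y
      then if r = 0 then (x # xs) ! c else (x # ys) ! r else undefined"
  have weight: "(\<Prod>b\<in>?Y. pvar (t b)) = (hook_weight (?to t) :: 'k pol)" for t
  proof -
    let ?P = "Pair (0::nat) ` Suc ` {..<p}" and ?Q = "(\<lambda>r. (r, 0::nat)) ` Suc ` {..<k}"
    have "?Y = insert (0, 0) (?P \<union> ?Q)"
      by (auto simp: image_iff less_Suc_eq_0_disj)
    then have "(\<Prod>b\<in>?Y. pvar (t b)) = (\<Prod>b\<in>insert (0, 0) (?P \<union> ?Q). pvar (t b))"
      by (rule arg_cong)
    also have "\<dots> = pvar (t (0, 0)) * (\<Prod>b\<in>?P \<union> ?Q. pvar (t b))"
      by (rule prod.insert) auto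
    also have "(\<Prod>b\<in>?P \<union> ?Q. pvar (t b)) = (\<Prod>b\<in>?P. pvar (t b)) * (\<Prod>b\<in>?Q. pvar (t b))"
      by (rule prod.union_disjoint) auto
    finally have "(\<Prod>b\<in>?Y. pvar (t b)) =
        pvar (t (0, 0)) * ((\<Prod>b\<in>?P. pvar (t b)) * (\<Prod>b\<in>?Q. pvar (t b)))" .
    then show ?thesis
      by (simp add: hook_weight_def prod_list_map_upt prod.reindex inj_on_def comp_def mult.assoc)
  qed
  have to: "?to t \<in> hook_fillings {1..N} p k" if "t \<in> ssyt N (hook (Suc p) (Suc k))" for t
  proof -
    have fin: "t \<in> ?Y \<rightarrow>\<^sub>E {1..N}"
      and row: "\<And>c c'. c < c' \<Longrightarrow> c' < Suc p \<Longrightarrow> t (0, c) \<le> t (0, c')"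
      and col: "\<And>r r'. r < r' \<Longrightarrow> r' < Suc k \<Longrightarrow> t (r, 0) < t (r', 0)"
      using that unfolding ssyt_def young_diagram_hook by auto
    have "t (0, c) \<in> {1..N}" if "c < Suc p" for c
      using PiE_mem[OF fin, of "(0, c)"] that by auto
    moreover have "t (r, 0) \<in> {1..N}" if "r < Suc k" for r
      using PiE_mem[OF fin, of "(r, 0)"] that by auto
    moreover have "sorted (map (\<lambda>c. t (0, c)) [0..<Suc p])"
      "sorted_wrt (<) (map (\<lambda>r. t (r, 0)) [0..<Suc k])"
      by (auto simp: sorted_wrt_iff_nth_less simp del: upt_Suc intro!: row col)
    ultimately show ?thesis
      unfolding map_upt_Suc by (auto simp: hook_fillings_def)
  qed
  have "from": "?from h \<in> ssyt N (hook (Suc p) (Suc k)) \<and> ?to (?from h) = h"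
    if "h \<in> hook_fillings {1..N} p k" for h
  proof -
    obtain x xs ys where h: "h = (x, xs, ys)" by (cases h)
    have len: "length xs = p" "length ys = k" and srt: "sorted (x # xs)" "sorted_wrt (<) (x # ys)"
      and sub: "set (x # xs) \<subseteq> {1..N}" "set (x # ys) \<subseteq> {1..N}"
      using that by (auto simp: hook_fillings_def h)
    have row: "(x # xs) ! c \<in> {1..N}" if "c < Suc p" for c
      using that sub(1) len by (intro subsetD[OF sub(1)] nth_mem) simp
    have col: "(x # ys) ! r \<in> {1..N}" if "r < Suc k" for r
      using that sub(2) len by (intro subsetD[OF sub(2)] nth_mem) simp
    have "?from h \<in> ?Y \<rightarrow>\<^sub>E {1..N}"
    proof (rule PiE_I)
      show "?from h b \<in> {1..N}" if "b \<in> ?Y" for b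
      proof (cases b)
        case (Pair r c)
        show ?thesis
        proof (cases "r = 0")
          case True
          then have "c < Suc p" using that Pair by auto
          then show ?thesis using row[of c] True by (simp add: h Pair)
        next
          case False
          then have "c = 0" "r < Suc k" using that Pair by auto
          then show ?thesis using col[of r] False by (simp add: h Pair)
        qed
      qed
      show "?from h b = undefined" if "b \<notin> ?Y" for b
        using that unfolding h by (cases b) auto
    qed
    moreover have "?from h (0, c) \<le> ?from h (0, c')" if "c < c'" "c' < Suc p" for c c'
      using sorted_wrt_nth_less[OF srt(1), of c c'] that len by (simp add: h)
    moreover have "?from h (r, 0) < ?from h (r', 0)" if "r < r'" "r' < Suc k" for r r'
      using sorted_wrt_nth_less[OF srt(2), of r r'] that len by (cases r) (auto simp: h)
    moreover have "?to (?from h) = h"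
      using len by (auto simp: h intro!: nth_equalityI)
    ultimately show ?thesis
      unfolding ssyt_def young_diagram_hook by auto
  qed
  have from_to: "?from (?to t) = t" if "t \<in> ssyt N (hook (Suc p) (Suc k))" for t
  proof
    fix b :: "nat \<times> nat"
    obtain r c where b: "b = (r, c)" by (cases b)
    have "t \<in> ?Y \<rightarrow>\<^sub>E {1..N}"
      using that unfolding ssyt_def young_diagram_hook by auto
    from PiE_arb[OF this, of "(r, c)"] show "?from (?to t) b = t b"
      unfolding b by (cases r; cases c) (auto simp del: upt_Suc)
  qed
  show ?thesis
    unfolding schur_def hook_schur_def young_diagram_hook
    by (rule sum.reindex_bij_witness[where i = ?from and j = ?to])
      (use to "from" from_to weight in auto)
qed

lemma no_const_hook_schur: "no_const (hook_schur A p k)"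
  unfolding hook_schur_def
proof (rule no_const_sum, clarify)
  fix x xs ys
  have "no_const (prod_list (map pvar xs) * prod_list (map pvar ys) * (pvar x :: 'a pol))"
    by (intro no_const_mult no_const_pvar)
  then show "no_const (hook_weight (x, xs, ys) :: 'a pol)"
    by (simp add: hook_weight_def ac_simps)
qed

text \<open>
  The first column would need \<open>k + 1\<close> distinct letters.
\<close>

lemma hook_schur_eq_0:
  assumes "finite A" "card A \<le> k"
  shows "hook_schur A p k = 0"
proof -
  have False if "(x, xs, ys) \<in> hook_fillings A p k" for x xs ys
  proof -
    have "distinct (x # ys)" "set (x # ys) \<subseteq> A" "length ys = k"
      using that by (auto simp: hook_fillings_def strict_sorted_iff)
    then show False
      using card_mono[OF assms(1), of "set (x # ys)"] assms(2) distinct_card[of "x # ys"] by simp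
  qed
  then have "hook_fillings A p k = {}"
    by auto
  then show ?thesis
    by (simp add: hook_schur_def)
qed

text \<open>
  The letter \<open>a\<close> can occur only in the corner and after it in the row. A filling without \<open>a\<close> is a
  filling over \<open>B\<close>. Otherwise the corner is \<open>a\<close>; it is removed, and the smaller one of the next row entry
  and the next column entry becomes the new corner. If this is the row entry (and strictly smaller),
  what remains is a filling with a shorter row in which \<open>a\<close> may still occur; if it is the column entry,
  what remains is a filling over \<open>B\<close> with a shorter column. The maps \<open>?row\<close> and \<open>?col\<close> in the proof are
  the inverses of these two removals.
\<close>

lemma hook_schur_insert_min:
  assumes "finite B" and min: "\<And>b. b \<in> B \<Longrightarrow> a < b"
  shows "(hook_schur (insert a B) p k :: 'k::comm_ring_1 pol) = hook_schur B p k
    + (if k = 0 then 0 else pvar a * hook_schur B p (k - 1))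
    + (if p = 0 then if k = 0 then pvar a else 0 else pvar a * hook_schur (insert a B) (p - 1) k)"
proof -
  let ?A = "insert a B"
  let ?row = "\<lambda>(x, xs, ys). (a, x # xs, ys)" and ?col = "\<lambda>(x, xs, ys). (a, xs, x # ys)"
  define C where "C = (if k = 0 then {} else ?col ` hook_fillings B p (k - 1))"
  define R where "R = (if p = 0 then if k = 0 then {(a, [], [])} else {}
    else ?row ` hook_fillings ?A (p - 1) k)"
  have CI: "(a, xs, y # ys) \<in> C" if "(y, xs, ys) \<in> hook_fillings B p (k - 1)" "k \<noteq> 0" for y xs ys
    using imageI[OF that(1), of ?col] that(2) by (simp add: C_def)
  have RI: "(a, x # xs, ys) \<in> R" if "(x, xs, ys) \<in> hook_fillings ?A (p - 1) k" "p \<noteq> 0" for x xs ys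
    using imageI[OF that(1), of ?row] that(2) by (simp add: R_def)
  have split: "hook_fillings ?A p k = (hook_fillings B p k \<union> C) \<union> R"
  proof (intro equalityI subsetI)
    fix h assume h: "h \<in> hook_fillings ?A p k"
    obtain x xs ys where h_eq: "h = (x, xs, ys)" by (cases h)
    have ah: "length xs = p" "length ys = k" "sorted (x # xs)" "sorted_wrt (<) (x # ys)"
      "x \<in> ?A" "set xs \<subseteq> ?A" "set ys \<subseteq> ?A"
      using h by (auto simp: hook_fillings_def h_eq)
    show "h \<in> (hook_fillings B p k \<union> C) \<union> R"
    proof (cases "x = a")
      case False
      then have "a < x" using ah(5) min by auto
      then have "a \<notin> set xs" "a \<notin> set ys" using ah by auto
      then have "h \<in> hook_fillings B p k"
        using ah False by (auto simp: hook_fillings_def h_eq)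
      then show ?thesis by simp
    next
      case True
      then have ysB: "set ys \<subseteq> B" using ah(4,7) by auto
      show ?thesis
      proof (cases xs)
        case Nil
        show ?thesis
        proof (cases ys)
          case Nil
          then show ?thesis using ah \<open>xs = []\<close> True by (simp add: R_def h_eq)
        next
          case (Cons y ys')
          have "(y, xs, ys') \<in> hook_fillings B p (k - 1)"
            using ah \<open>xs = []\<close> Cons ysB by (auto simp: hook_fillings_def)
          from CI[OF this] show ?thesis using ah(2) Cons True by (auto simp: h_eq)
        qed
      next
        case xs: (Cons x' xs')
        show ?thesis
        proof (cases "sorted_wrt (<) (x' # ys)")
          case row_strict: True
          have "(x', xs', ys) \<in> hook_fillings ?A (p - 1) k"
            using ah xs row_strict by (auto simp: hook_fillings_def)
          from RI[OF this] show ?thesis using ah(1) xs True by (auto simp: h_eq)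
        next
          case False
          then obtain y ys' where ys: "ys = y # ys'"
            by (cases ys) auto
          have "y \<le> x'"
          proof (rule ccontr)
            assume "\<not> y \<le> x'"
            then have "sorted_wrt (<) (x' # ys)"
              using ah(4) by (auto simp: ys intro: less_trans)
            with False show False ..
          qed
          have "a \<notin> set xs"
            using ah(3) ys ysB min[of y] xs \<open>y \<le> x'\<close> by auto
          then have "(y, xs, ys') \<in> hook_fillings B p (k - 1)"
            using ah ys ysB xs \<open>y \<le> x'\<close> by (auto simp: hook_fillings_def)
          from CI[OF this] show ?thesis using ah(2) ys True by (auto simp: h_eq)
        qed
      qed
    qed
  next
    fix h assume "h \<in> (hook_fillings B p k \<union> C) \<union> R"
    then consider "h \<in> hook_fillings B p k" | "h \<in> C" | "h \<in> R" by blast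
    then show "h \<in> hook_fillings ?A p k"
    proof cases
      case 1
      then show ?thesis by (auto simp: hook_fillings_def)
    next
      case 2
      then show ?thesis using min
        by (auto simp: C_def hook_fillings_def split: if_splits) (meson less_imp_le order_less_trans subsetD)+
    next
      case 3
      then show ?thesis using min
        by (auto simp: R_def hook_fillings_def split: if_splits) (fastforce intro: less_imp_le order_less_le_trans)+
    qed
  qed
  have fin: "finite (hook_fillings B p k)" "finite C" "finite R"
    using assms by (auto simp: C_def R_def finite_hook_fillings)
  have "a \<notin> B" using min by auto
  moreover have "fst h \<in> B" if "h \<in> hook_fillings B p k" for h
    using that by (auto simp: hook_fillings_def)
  moreover have "fst h = a" if "h \<in> C \<union> R" for h
    using that by (auto simp: C_def R_def split: if_splits)
  moreover have False if CR: "h \<in> C" "h \<in> R" for h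
  proof -
    obtain y xs ys where h: "h = (a, xs, y # ys)" "sorted (y # xs)" "length xs = p"
    proof -
      have "h \<in> ?col ` hook_fillings B p (k - 1)"
        using CR(1) by (simp add: C_def split: if_splits)
      then obtain y xs ys where "h = (a, xs, y # ys)" "(y, xs, ys) \<in> hook_fillings B p (k - 1)"
        by auto
      then show thesis
        by (intro that) (auto simp: hook_fillings_def)
    qed
    have "k \<noteq> 0"
      using CR(1) by (simp add: C_def split: if_splits)
    then have "h \<in> ?row ` hook_fillings ?A (p - 1) k"
      using CR(2) by (simp add: R_def split: if_splits)
    then obtain x xs' where "xs = x # xs'" "x < y"
      using h(1) by (auto simp: hook_fillings_def)
    with h(2) show False
      by simp
  qed
  ultimately have disj: "hook_fillings B p k \<inter> C = {}" "(hook_fillings B p k \<union> C) \<inter> R = {}"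
    by blast+
  have "sum hook_weight (?col ` X) = pvar a * (sum hook_weight X :: 'k pol)"
    "sum hook_weight (?row ` X) = pvar a * (sum hook_weight X :: 'k pol)" for X
  proof -
    have "inj_on ?col X" "inj_on ?row X"
      by (auto simp: inj_on_def)
    moreover have "hook_weight (?col h) = pvar a * (hook_weight h :: 'k pol)"
      "hook_weight (?row h) = pvar a * (hook_weight h :: 'k pol)" for h
      by (cases h; simp add: hook_weight_def ac_simps)+
    ultimately show "sum hook_weight (?col ` X) = pvar a * (sum hook_weight X :: 'k pol)"
      "sum hook_weight (?row ` X) = pvar a * (sum hook_weight X :: 'k pol)"
      by (simp_all only: sum.reindex comp_def sum_distrib_left)
  qed
  then have "sum hook_weight C = (if k = 0 then 0 else pvar a * hook_schur B p (k - 1) :: 'k pol)"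
    "sum hook_weight R = (if p = 0 then if k = 0 then pvar a else 0
       else pvar a * hook_schur ?A (p - 1) k :: 'k pol)"
    by (simp_all add: C_def R_def hook_schur_def) (simp add: hook_weight_def)
  then show ?thesis
    by (simp add: hook_schur_def split sum.union_disjoint fin disj)
qed

section \<open>Coherent vectors and the operators in the identity\<close>

context charged_free_bosons_fock
begin

text \<open>
  The modes \<open>\<phi>\<^bsub>-m\<^esub>\<close> and \<open>\<phi>\<^sup>*\<^bsub>1-n\<^esub>\<close> with \<open>m, n \<ge> 1\<close> are exactly those that do not annihilate the vacuum.
\<close>

definition quadratic :: "nat \<Rightarrow> nat \<Rightarrow> (nat \<Rightarrow> nat \<Rightarrow> 'k pol) \<Rightarrow> 'v series \<Rightarrow> 'v series" where
  "quadratic M N c F = (\<Sum>m=1..M. \<Sum>n=1..N. act (c m n) (- int m) (1 - int n) F)"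

lemma quadratic_cong:
  assumes "\<And>m n. \<lbrakk>1 \<le> m; m \<le> M; 1 \<le> n; n \<le> N\<rbrakk> \<Longrightarrow> c m n = d m n"
  shows "quadratic M N c = quadratic M N d"
  unfolding quadratic_def using assms by (auto intro!: ext sum.cong)

lemma quadratic_add: "quadratic M N c F + quadratic M N d F = quadratic M N (\<lambda>m n. c m n + d m n) F"
  by (simp add: quadratic_def act_add sum.distrib)

lemma quadratic_zero: "quadratic M N (\<lambda>m n. 0) F = 0"
  by (simp add: quadratic_def act_0)

lemma raises_quadratic:
  assumes "\<And>m n. no_const (c m n)"
  shows "raises 1 (quadratic M N c)"
  unfolding quadratic_def[abs_def] by (intro raises_sum raises_act assms)

lemma act_quadratic:
  assumes "no_const p"
  shows "act p a b (quadratic M N c F) = quadratic M N c (act p a b F)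
    + ((\<Sum>m=1..M. \<Sum>n=1..N. if a = int n - 1 then act (p * c m n) (- int m) b F else 0)
       - (\<Sum>m=1..M. \<Sum>n=1..N. if int m = b then act (p * c m n) a (1 - int n) F else 0))"
  unfolding quadratic_def raises_linear(5)[OF raises_act[OF assms]] sum.distrib[symmetric] sum_subtractf[symmetric]
  by (intro sum.cong refl) (simp add: act_act[of p])

lemma quadratic_commute:
  assumes "\<And>m n. no_const (c m n)" "\<And>m n. no_const (d m n)"
  shows "quadratic M N c (quadratic M N d F) = quadratic M N d (quadratic M N c F)"
proof -
  have "act (c m n) (- int m) (1 - int n) (quadratic M N d F) = quadratic M N d (act (c m n) (- int m) (1 - int n) F)"
    if "m \<ge> 1" "n \<ge> 1" for m n
    unfolding act_quadratic[OF assms(1)] using that by (auto intro!: sum.neutral)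
  then have "quadratic M N c (quadratic M N d F) =
      (\<Sum>m=1..M. \<Sum>n=1..N. quadratic M N d (act (c m n) (- int m) (1 - int n) F))"
    unfolding quadratic_def[of M N c] by (intro sum.cong) auto
  also have "\<dots> = quadratic M N d (quadratic M N c F)"
    unfolding quadratic_def[of M N c] raises_linear(5)[OF raises_quadratic[OF assms(2)]] ..
  finally show ?thesis .
qed

text \<open>
  The matrix by which the factor \<open>exp (p \<phi>\<^bsub>-k\<^esub> \<phi>\<^sup>*\<^bsub>k-1\<^esub>)\<close> changes the matrix \<open>c\<close> of a coherent vector. For
  \<open>k \<noteq> 1\<close> it describes the commutator of \<open>p \<phi>\<^bsub>-k\<^esub> \<phi>\<^sup>*\<^bsub>k-1\<^esub>\<close> with \<open>quadratic M N c\<close>: contraction with \<open>\<phi>\<^bsub>-(k-1)\<^esub>\<close>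
  feeds row \<open>k - 1\<close> into row \<open>k\<close>, and contraction with \<open>\<phi>\<^sup>*\<^bsub>k\<^esub>\<close> feeds column \<open>1 - k\<close> into column \<open>2 - k\<close>. For
  \<open>k = 1\<close> it is the operator itself.
\<close>

definition commutator_coeff :: "int \<Rightarrow> 'k pol \<Rightarrow> (nat \<Rightarrow> nat \<Rightarrow> 'k pol) \<Rightarrow> nat \<Rightarrow> nat \<Rightarrow> 'k pol" where
  "commutator_coeff k p c m n =
    (if k \<ge> 2 then if int m = k then - (p * c (m - 1) n) else 0
     else if k = 1 then if m = 1 \<and> n = 1 then p else 0
     else if int n = 2 - k then p * c m (n - 1) else 0)"

lemma no_const_commutator_coeff:
  assumes "no_const p" "\<And>m n. no_const (c m n)"
  shows "no_const (commutator_coeff k p c m n)"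
  using assms by (auto simp: commutator_coeff_def intro: no_const_0 no_const_uminus no_const_mult)

text \<open>
  The commutator must not leave the \<open>M \<times> N\<close> range. The bound \<open>k \<le> M\<close> keeps row \<open>k\<close> inside; if column \<open>1 - k\<close> is
  the last one, its image would be column \<open>N + 1\<close>, so this column has to vanish.
\<close>

lemma act_quadratic_commutator:
  assumes p: "no_const p" and k: "k \<noteq> 1" "k \<le> int M"
    and c: "\<And>m. int N = 1 - k \<Longrightarrow> c m N = 0"
  shows "act p (- k) (k - 1) (quadratic M N c F) =
    quadratic M N c (act p (- k) (k - 1) F) + quadratic M N (commutator_coeff k p c) F"
proof (cases "k \<ge> 2")
  case True
  then obtain j where j: "k = int (Suc j)" "1 \<le> j"
    by (intro that[of "nat (k - 1)"]) auto
  have "(\<Sum>m=1..M. \<Sum>n=1..N. if - k = int n - 1 then act (p * c m n) (- int m) (k - 1) F else 0) = 0"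
    using True by (intro sum.neutral) auto
  moreover have "(\<Sum>m=1..M. \<Sum>n=1..N. if int m = k - 1 then act (p * c m n) (- k) (1 - int n) F else 0)
      = (\<Sum>m=1..M. if m = j then \<Sum>n=1..N. act (p * c m n) (- k) (1 - int n) F else 0)"
    by (intro sum.cong) (auto simp: j)
  moreover have commutator_coeff: "commutator_coeff k p c m n = (if m = Suc j then - (p * c j n) else 0)" for m n
    using j by (auto simp: commutator_coeff_def)
  have "quadratic M N (commutator_coeff k p c) F =
      (\<Sum>m=1..M. if m = Suc j then \<Sum>n=1..N. - act (p * c j n) (- k) (1 - int n) F else 0)"
    unfolding quadratic_def commutator_coeff by (intro sum.cong) (simp_all add: j act_0 act_uminus)
  ultimately show ?thesis
    unfolding act_quadratic[OF p] using k j by (simp add: sum_negf)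
next
  case False
  then obtain j where j: "k = 1 - int j" "1 \<le> j"
    using k(1) by (intro that[of "nat (1 - k)"]) auto
  have "(\<Sum>m=1..M. \<Sum>n=1..N. if int m = k - 1 then act (p * c m n) (- k) (1 - int n) F else 0) = 0"
    using False by (intro sum.neutral) auto
  moreover have commutator_coeff: "commutator_coeff k p c m n = (if n = Suc j then p * c m j else 0)" for m n
    using j by (auto simp: commutator_coeff_def)
  have "(\<Sum>n=1..N. if - k = int n - 1 then act (p * c m n) (- int m) (k - 1) F else 0)
      = (\<Sum>n=1..N. act (commutator_coeff k p c m n) (- int m) (1 - int n) F)" for m
  proof -
    have "(\<Sum>n=1..N. if - k = int n - 1 then act (p * c m n) (- int m) (k - 1) F else 0)
        = (\<Sum>n=1..N. if n = j then act (p * c m j) (- int m) (- int j) F else 0)"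
      by (intro sum.cong) (auto simp: j)
    also have "\<dots> = (\<Sum>n=1..N. if n = Suc j then act (p * c m j) (- int m) (- int j) F else 0)"
    proof (cases "j = N")
      case True
      then show ?thesis using c[of m] by (simp add: j act_0)
    qed (use j in auto)
    also have "\<dots> = (\<Sum>n=1..N. act (commutator_coeff k p c m n) (- int m) (1 - int n) F)"
      unfolding commutator_coeff by (intro sum.cong) (simp_all add: act_0)
    finally show ?thesis .
  qed
  ultimately show ?thesis
    unfolding act_quadratic[OF p] by (simp add: quadratic_def[of M N "commutator_coeff k p c"])
qed

text \<open>
  For \<open>k \<ge> 2\<close> the starred mode annihilates the vacuum; for \<open>k \<le> 0\<close> the unstarred one does, and the two
  modes commute.
\<close>

lemma act_vac_eq_0:
  assumes "k \<noteq> 1"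
  shows "act p (- k) (k - 1) (const_series vac) = 0"
proof -
  have "phi (- k) (phis (k - 1) vac) = 0"
  proof (cases "k \<ge> 2")
    case True
    then show ?thesis using phis_vac[of "k - 2"] by (simp add: phi_zero)
  next
    case False
    then show ?thesis
      using assms comm_phi_phis[of "- k" "k - 1" vac] phi_vac[of "- k"] by (simp add: phis_zero)
  qed
  then have "(\<lambda>\<alpha>. phi (- k) (phis (k - 1) (const_series vac \<alpha>))) = 0"
    by (auto simp: fun_eq_iff const_series_def phi_zero phis_zero)
  then show ?thesis
    using raises_linear(4)[OF raises_pol_mult[of 0 p]] by (simp add: bilin_def)
qed

text \<open>
  The exponential of a quadratic expression in creation operators, applied to the vacuum, is a
  coherent state in the terminology of physics.
\<close>

definition coherent :: "nat \<Rightarrow> nat \<Rightarrow> (nat \<Rightarrow> nat \<Rightarrow> 'k pol) \<Rightarrow> 'v series" where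
  "coherent M N c = op_exp scale (quadratic M N c) (const_series vac)"

lemma op_exp_act_coherent:
  assumes p: "no_const p" and nc: "\<And>m n. no_const (c m n)"
    and k: "k \<le> int M" and MN: "1 \<le> M" "1 \<le> N"
    and c: "\<And>m. int N = 1 - k \<Longrightarrow> c m N = 0"
  shows "op_exp scale (act p (- k) (k - 1)) (coherent M N c)
    = coherent M N (\<lambda>m n. commutator_coeff k p c m n + c m n)"
proof -
  let ?A = "act p (- k) (k - 1)" and ?H = "quadratic M N c" and ?D = "quadratic M N (commutator_coeff k p c)"
  have A: "raises 1 ?A" and H: "raises 1 ?H" and D: "raises 1 ?D"
    by (intro raises_act raises_quadratic no_const_commutator_coeff p nc)+
  have HD: "?H (?D F) = ?D (?H F)" for F
    by (intro quadratic_commute nc no_const_commutator_coeff p)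
  have "op_exp scale ?A (coherent M N c) = op_exp scale (\<lambda>F. ?D F + ?H F) (const_series vac)"
  proof (cases "k = 1")
    case True
    have "act (commutator_coeff k p c m n) (- int m) (1 - int n) F =
        (if n = 1 then if m = 1 then act p (- 1) 0 F else 0 else 0)" for m n F
      by (auto simp: commutator_coeff_def True act_0)
    then have "?A = ?D"
      using MN by (auto simp: quadratic_def True)
    then show ?thesis
      unfolding coherent_def by (simp only: op_exp_add[OF D H HD])
  next
    case False
    \<comment> \<open>The commutator moves row \<open>k - 1\<close> to row \<open>k\<close>, or column \<open>1 - k\<close> to column \<open>2 - k\<close>, so it vanishes
      when taken twice.\<close>
    have "commutator_coeff k p (commutator_coeff k p c) = (\<lambda>m n. 0)"
      using False by (auto simp: fun_eq_iff commutator_coeff_def)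
    moreover have "commutator_coeff k p c m N = 0" if "int N = 1 - k" for m
      using False that MN by (auto simp: commutator_coeff_def)
    ultimately have AD: "?A (?D F) = ?D (?A F)" for F
      using act_quadratic_commutator[OF p False k, of N "commutator_coeff k p c" F] by (simp add: quadratic_zero)
    have AH: "?A (?H F) = ?H (?A F) + ?D F" for F
      by (rule act_quadratic_commutator[OF p False k]) (rule c)
    show ?thesis
      unfolding coherent_def
      by (rule op_exp_op_exp[OF A H D AH AD HD act_vac_eq_0[OF False]])
  qed
  then show ?thesis
    by (simp add: quadratic_add coherent_def)
qed

text \<open>
  The matrix \<open>e k\<close> in the proof is the state reached after the factors with index at most \<open>k\<close>: the
  rows up to \<open>k\<close> have their final value \<open>d\<close>, and elsewhere the columns from \<open>2 - k\<close> on have already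
  received the contribution of the column before them. For \<open>k \<le> - N\<close> no entry in the range has
  changed, so on this vector the partial products of \<open>B\<^sup>*\<close> are constant from \<open>M + N\<close> factors on. The assumption that the last column of \<open>c\<close>
  vanishes keeps the new matrix within \<open>N\<close> columns.
\<close>

lemma Bstar_coherent:
  fixes j :: nat
  defines "x \<equiv> pvar j"
  assumes MN: "1 \<le> M" "1 \<le> N"
    and nc: "\<And>m n. no_const (c m n)" "\<And>m n. no_const (d m n)" and c: "\<And>m. c m N = 0"
    and d: "\<And>m n. 1 \<le> m \<Longrightarrow> 1 \<le> n \<Longrightarrow> d m n = c m n + (if n = 1 then 0 else x * c m (n - 1))
       + (if m = 1 then if n = 1 then x else 0 else - (x * d (m - 1) n))"
  shows "Bstar scale phi phis M j (coherent M N c) = coherent M N d"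
proof -
  define u where "u m n = c m n + (if n = 1 then 0 else x * c m (n - 1))" for m n
  define e where "e k m n = (if int m \<le> k then d m n else if 2 - k \<le> int n then u m n else c m n)"
    for k m n
  have nce: "no_const (e k m n)" for k m n
    using nc by (auto simp: e_def u_def intro: no_const_add no_const_mult no_const_0)
  have step: "op_exp scale (act x (- k) (k - 1)) (coherent M N (e (k - 1))) = coherent M N (e k)"
    if "k \<le> int M" for k
  proof -
    have "op_exp scale (act x (- k) (k - 1)) (coherent M N (e (k - 1)))
        = coherent M N (\<lambda>m n. commutator_coeff k x (e (k - 1)) m n + e (k - 1) m n)"
    proof (rule op_exp_act_coherent[where c = "e (k - 1)", OF _ nce that MN])
      show "no_const x"
        by (simp add: x_def no_const_pvar)
      show "e (k - 1) m N = 0" if "int N = 1 - k" for m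
        using that MN c by (simp add: e_def)
    qed
    also have "quadratic M N (\<lambda>m n. commutator_coeff k x (e (k - 1)) m n + e (k - 1) m n) = quadratic M N (e k)"
    proof (rule quadratic_cong)
      fix m n :: nat
      assume mn: "1 \<le> m" "1 \<le> n"
      consider "k \<ge> 2" | "k = 1" | "k \<le> 0" by linarith
      then show "commutator_coeff k x (e (k - 1)) m n + e (k - 1) m n = e k m n"
      proof cases
        case 1
        then show ?thesis using mn d[OF mn] by (auto simp: commutator_coeff_def e_def u_def)
      next
        case 2
        then show ?thesis using mn d[OF mn] by (auto simp: commutator_coeff_def e_def u_def)
      next
        case 3
        then show ?thesis using mn by (auto simp: commutator_coeff_def e_def u_def)
      qed
    qed
    then have "coherent M N (\<lambda>m n. commutator_coeff k x (e (k - 1)) m n + e (k - 1) m n) = coherent M N (e k)"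
      by (simp add: coherent_def)
    finally show ?thesis .
  qed
  have partial: "Bstar_partial scale phi phis M j n (coherent M N (e (int M - int n))) = coherent M N (e (int M))"
    for n
  proof (induction n)
    case (Suc n)
    have "Bstar_partial scale phi phis M j (Suc n) F =
        Bstar_partial scale phi phis M j n
          (op_exp scale (act x (- (int M - int n)) (int M - int n - 1)) F)" for F
      by (simp add: Bstar_partial_def Let_def x_def)
    then show ?case
      using Suc step[of "int M - int n"] by (simp add: algebra_simps)
  qed (simp add: Bstar_partial_def)
  have start: "coherent M N (e (int M - int n)) = coherent M N c" if "M + N \<le> n" for n
    unfolding coherent_def using that by (subst quadratic_cong[of M N _ c]) (auto simp: e_def)
  have "coherent M N (e (int M)) = coherent M N d"
    unfolding coherent_def by (subst quadratic_cong[of M N _ d]) (auto simp: e_def)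
  then have "Bstar_partial scale phi phis M j n (coherent M N c) \<alpha> = coherent M N d \<alpha>"
    if "M + N \<le> n" for n \<alpha>
    using partial[of n] start[OF that] by simp
  then show ?thesis
    unfolding Bstar_def by (intro series_limI eventually_sequentiallyI[of "M + N"])
qed

definition hook_coeff :: "nat set \<Rightarrow> nat \<Rightarrow> nat \<Rightarrow> 'k pol" where
  "hook_coeff A m n = (- 1) ^ (m - 1) * hook_schur A (m - 1) (n - 1)"

text \<open>
  Over the alphabet \<open>{j + 1..N}\<close> with \<open>j \<ge> 1\<close> there is no strictly increasing column of length \<open>N\<close>, so the
  last column of the matrix vanishes and lemma \<open>Bstar_coherent\<close> applies.
\<close>

lemma foldr_Bstar_vac:
  assumes MN: "1 \<le> M" "1 \<le> N" and j: "1 \<le> j" "j \<le> N + 1"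
  shows "foldr (\<lambda>j. Bstar scale phi phis M j) [j..<N + 1] (const_series vac)
    = coherent M N (hook_coeff {j..N})"
  using j(2,1)
proof (induction j rule: inc_induct)
  case base
  have "hook_coeff {N + 1..N} = (\<lambda>m n. 0)"
    by (simp add: fun_eq_iff hook_coeff_def hook_schur_eq_0)
  then show ?case
    by (simp add: coherent_def quadratic_zero[abs_def] op_exp_zero_op)
next
  case (step j)
  let ?c = "hook_coeff {Suc j..N}" and ?d = "hook_coeff {j..N}"
  have "Bstar scale phi phis M j (coherent M N ?c) = coherent M N ?d"
  proof (rule Bstar_coherent[OF MN])
    show "no_const (hook_coeff A m n)" for A m n
      by (simp add: hook_coeff_def no_const_mult no_const_hook_schur)
    then show "no_const (hook_coeff A m n)" for A m n .
    show "?c m N = 0" for m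
      using step by (simp add: hook_coeff_def hook_schur_eq_0)
  next
    fix m n :: nat
    assume "1 \<le> m" "1 \<le> n"
    then obtain p k where [simp]: "m = Suc p" "n = Suc k"
      by (metis One_nat_def Suc_le_D)
    have alphabet: "{j..N} = insert j {Suc j..N}"
      using step by auto
    have "(hook_schur {j..N} p k :: 'k pol) = hook_schur {Suc j..N} p k
      + (if k = 0 then 0 else pvar j * hook_schur {Suc j..N} p (k - 1))
      + (if p = 0 then if k = 0 then pvar j else 0 else pvar j * hook_schur {j..N} (p - 1) k)"
      unfolding alphabet by (rule hook_schur_insert_min) auto
    then show "?d m n = ?c m n + (if n = 1 then 0 else pvar j * ?c m (n - 1))
       + (if m = 1 then if n = 1 then pvar j else 0 else - (pvar j * ?d (m - 1) n))"
      by (cases p) (simp_all add: hook_coeff_def algebra_simps)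
  qed
  moreover have "[j..<N + 1] = j # [Suc j..<N + 1]"
    using step by (intro upt_conv_Cons) simp
  ultimately show ?case
    using step by (simp del: upt_Suc add: comp_def)
qed

lemma foldr_Bstar_vac_eq_op_exp:
  assumes "1 \<le> M" "1 \<le> N"
  shows "foldr (\<lambda>j. Bstar scale phi phis M j) [1..<N + 1] (const_series vac) =
         op_exp scale (hook_exponent scale phi phis M N) (const_series vac)"
proof -
  have "hook_exponent scale phi phis M N = quadratic M N (\<lambda>m n. (- 1) ^ (m - 1) * schur N (hook m n))"
    by (intro ext) (simp add: hook_exponent_def quadratic_def sum_series_apply)
  also have "\<dots> = quadratic M N (hook_coeff {1..N})"
  proof (rule quadratic_cong)
    fix m n :: nat
    assume "1 \<le> m" "1 \<le> n"
    then show "(- 1) ^ (m - 1) * schur N (hook m n) = hook_coeff {1..N} m n"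
      using schur_hook_eq_hook_schur[of N "m - 1" "n - 1"] by (simp add: hook_coeff_def)
  qed
  finally show ?thesis
    using foldr_Bstar_vac[OF assms, of 1] by (simp add: coherent_def)
qed

end

theorem theorem3p1:
  fixes scale :: "'k::field_char_0 \<Rightarrow> 'v::ab_group_add \<Rightarrow> 'v"
    and phi phis :: "int \<Rightarrow> 'v \<Rightarrow> 'v"
    and vac :: 'v
    and M N :: nat
  assumes "charged_free_bosons_fock scale phi phis vac"
    and "M \<ge> 1" and "N \<ge> 1"
  shows "foldr (\<lambda>j. Bstar scale phi phis M j) [1..<N + 1] (const_series vac) =
         op_exp scale (hook_exponent scale phi phis M N) (const_series vac)"
proof -
  interpret charged_free_bosons_fock scale phi phis vac
    by (rule assms(1))
  show ?thesis
    by (rule foldr_Bstar_vac_eq_op_exp[OF assms(2,3)])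
qed

end
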